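(* Suppose that the problem $\inf_{A\in\mathcal{A}}\mathcal{L}(A)$ admits a minimizer $A^*\in\mathcal{A}$. Then there exists $\varepsilon_0>0$ such that, for all $\varepsilon\in(0,\varepsilon_0)$, $A^*$ belongs to $\mathcal{A}_\varepsilon$ and is a minimizer of $\mathcal{L}$ over $\mathcal{A}_\varepsilon$.
   Context: Let $d\ge 1$, let $\Omega\subset\mathbb{R}^d$ be a bounded smooth connected open set with outward unit normal $\nu$, and let $K\subset\Omega$ be a fixed compact set. Let $(g_N,g_D)\in H^{-1/2}(\partial\Omega)\times H^{1/2}(\partial\Omega)$ be a given non-trivial pair. Admissible sets: $\mathcal{A}=\{A=\Omega\setminus\overline{\omega}:\ \omega \text{ open},\ \omega\subset K,\ \omega\text{ Lipschitz}\}$. An open set $\Theta\subset\mathbb{R}^d$ has the $\varepsilon$-cone property if for every $x\in\partial\Theta$ there is a unit vector $\xi_x$ such that for all $y\in\overline{\Theta}\cap \mathcal{B}(x,\varepsilon)$ one has $C(y,\xi_x,\varepsilon)\subset\Theta$, where $C(y,\xi,\varepsilon)=\{z\in\mathbb{R}^d:\ (z-y,\xi)\ge\cos(\varepsilon)|z-y|,\ 0<|z-y|<\varepsilon\}$ and $\mathcal{B}(x,\varepsilon)$ is the ball of center $x$ and radius $\varepsilon$. For $\varepsilon>0$, $\mathcal{A}_\varepsilon=\{A=\Omega\setminus\overline{\omega}:\ \omega\text{ open},\ \omega\subset K,\ \omega^c\text{ has the }\varepsilon\text{-cone property}\}$, where "$\omega^c$ has the $\varepsilon$-cone property" means that the open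 set $\mathbb{R}^d\setminus\overline{\omega}$ has it. One has $\mathcal{A}_\varepsilon\subset\mathcal{A}$. Functional: for $A=\Omega\setminus\overline{\omega}\in\mathcal{A}$, $\mathcal{L}(A)=\frac12\int_{\partial\Omega}|u-g_D|^2$, where $u\in H^1(A)$ is the (unique, weak) solution of $-\Delta u+u=0$ in $A$, $\partial_\nu u=g_N$ on $\partial\Omega$, $u=0$ on $\partial\omega$. *)

theory Defs
  imports "HOL-Analysis.Analysis"
begin

section \<open>Smooth functions, Lipschitz and smooth open sets, the cone property\<close>

primrec Ck_on :: "nat \<Rightarrow> 'a::euclidean_space set \<Rightarrow> ('a \<Rightarrow> real) \<Rightarrow> bool" where
  "Ck_on 0 S f \<longleftrightarrow> continuous_on S f"
| "Ck_on (Suc k) S f \<longleftrightarrow>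
     f differentiable_on S \<and> (\<forall>b\<in>Basis. Ck_on k S (\<lambda>x. frechet_derivative f (at x) b))"

text \<open>Only used for open \<open>S\<close>.\<close>
definition smooth_on :: "'a::euclidean_space set \<Rightarrow> ('a \<Rightarrow> real) \<Rightarrow> bool" where
  "smooth_on S f \<longleftrightarrow> (\<forall>k. Ck_on k S f)"

definition gradient :: "('a::euclidean_space \<Rightarrow> real) \<Rightarrow> 'a \<Rightarrow> 'a" where
  "gradient f x = (\<Sum>b\<in>Basis. frechet_derivative f (at x) b *\<^sub>R b)"

text \<open>For a unit vector \<open>e\<close>, the component of \<open>v\<close> orthogonal to \<open>e\<close>.\<close>
definition perp :: "'a::euclidean_space \<Rightarrow> 'a \<Rightarrow> 'a" where
  "perp e v = v - (v \<bullet> e) *\<^sub>R e"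

definition cylinder :: "'a::euclidean_space \<Rightarrow> 'a \<Rightarrow> real \<Rightarrow> real \<Rightarrow> 'a set" where
  "cylinder x e r h = {y. norm (perp e (y - x)) < r \<and> \<bar>(y - x) \<bullet> e\<bar> < h}"

text \<open>
  \<open>U\<close> lies, near every boundary point and in suitable orthonormal coordinates with vertical
  direction \<open>e\<close>, strictly below a graph of regularity \<open>reg\<close>. The function \<open>\<phi>\<close> of the horizontal
  variable is a function on the disc of radius \<open>r\<close> of the hyperplane orthogonal to \<open>e\<close>; its
  regularity is that of \<open>\<phi> \<circ> perp e\<close>, its extension to the open vertical strip above that disc
  which does not depend on the vertical variable. An open set with empty boundary qualifies.
\<close>
definition boundary_of_class ::
    "('a::euclidean_space set \<Rightarrow> ('a \<Rightarrow> real) \<Rightarrow> bool) \<Rightarrow> 'a set \<Rightarrow> bool" where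
  "boundary_of_class reg U \<longleftrightarrow>
     (\<forall>x\<in>frontier U. \<exists>e r h \<phi>. norm e = 1 \<and> r > 0 \<and> h > 0 \<and>
        reg {z. norm (perp e z) < r} (\<phi> \<circ> perp e) \<and>
        U \<inter> cylinder x e r h = {y \<in> cylinder x e r h. (y - x) \<bullet> e < \<phi> (perp e (y - x))} \<and>
        frontier U \<inter> cylinder x e r h =
          {y \<in> cylinder x e r h. (y - x) \<bullet> e = \<phi> (perp e (y - x))})"

definition lipschitz_open :: "'a::euclidean_space set \<Rightarrow> bool" where
  "lipschitz_open U \<longleftrightarrow> open U \<and> boundary_of_class (\<lambda>S \<psi>. \<exists>L. L-lipschitz_on S \<psi>) U"

definition smooth_open :: "'a::euclidean_space set \<Rightarrow> bool" where
  "smooth_open U \<longleftrightarrow> open U \<and> boundary_of_class smooth_on U"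

definition cone :: "'a::euclidean_space \<Rightarrow> 'a \<Rightarrow> real \<Rightarrow> 'a set" where
  "cone y \<xi> \<epsilon> = {z. (z - y) \<bullet> \<xi> \<ge> cos \<epsilon> * norm (z - y) \<and> 0 < norm (z - y) \<and> norm (z - y) < \<epsilon>}"

definition cone_property :: "real \<Rightarrow> 'a::euclidean_space set \<Rightarrow> bool" where
  "cone_property \<epsilon> \<Theta> \<longleftrightarrow>
     (\<forall>x\<in>frontier \<Theta>. \<exists>\<xi>. norm \<xi> = 1 \<and> (\<forall>y\<in>closure \<Theta> \<inter> ball x \<epsilon>. cone y \<xi> \<epsilon> \<subseteq> \<Theta>))"

section \<open>Surface measure\<close>

text \<open>
  The empty set is treated separately because \<open>diameter {} ^ 0 = 1\<close>; for \<open>s = 0\<close> singletons then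
  have measure 1, so that the surface measure in dimension one is the counting measure.
\<close>
definition hausdorff_outer :: "nat \<Rightarrow> 'a::euclidean_space set \<Rightarrow> ennreal" where
  "hausdorff_outer s E =
     (SUP \<delta>\<in>{0<..}. INF C\<in>{C :: nat \<Rightarrow> 'a set.
          E \<subseteq> (\<Union>i. C i) \<and> (\<forall>i. bounded (C i) \<and> diameter (C i) \<le> \<delta>)}.
        (\<Sum>i. if C i = {} then 0
              else ennreal (unit_ball_vol (real s) * (diameter (C i) / 2) ^ s)))"

text \<open>
  The outer measure is a metric one, hence by Caratheodory's criterion countably additive on the
  Borel sets, which is what \<open>measure_of\<close> requires.
\<close>
definition hausdorff_measure :: "nat \<Rightarrow> 'a::euclidean_space measure" where
  "hausdorff_measure s = measure_of UNIV (sets borel) (hausdorff_outer s)"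

definition surface_measure :: "'a::euclidean_space set \<Rightarrow> 'a measure" where
  "surface_measure \<Gamma> = restrict_space (hausdorff_measure (DIM('a) - 1)) \<Gamma>"

section \<open>The spaces $H^1(A)$, $H^{1/2}(\Gamma)$, $H^{-1/2}(\Gamma)$ and traces\<close>

text \<open>Elements of function spaces are represented by functions rather than by a.e. classes.\<close>

definition square_integrable :: "'a measure \<Rightarrow> ('a \<Rightarrow> 'b::euclidean_space) \<Rightarrow> bool" where
  "square_integrable M f \<longleftrightarrow> f \<in> borel_measurable M \<and> integrable M (\<lambda>x. (norm (f x))\<^sup>2)"

definition test_function :: "'a::euclidean_space set \<Rightarrow> ('a \<Rightarrow> real) \<Rightarrow> bool" where
  "test_function A \<phi> \<longleftrightarrow>
     smooth_on UNIV \<phi> \<and> compact (closure {x. \<phi> x \<noteq> 0}) \<and> closure {x. \<phi> x \<noteq> 0} \<subseteq> A"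

definition is_weak_gradient ::
    "'a::euclidean_space set \<Rightarrow> ('a \<Rightarrow> real) \<Rightarrow> ('a \<Rightarrow> 'a) \<Rightarrow> bool" where
  "is_weak_gradient A u G \<longleftrightarrow> square_integrable (lebesgue_on A) G \<and>
     (\<forall>\<phi>. test_function A \<phi> \<longrightarrow>
        (LINT x|lebesgue_on A. u x *\<^sub>R gradient \<phi> x) = - (LINT x|lebesgue_on A. \<phi> x *\<^sub>R G x))"

definition H1 :: "'a::euclidean_space set \<Rightarrow> ('a \<Rightarrow> real) set" where
  "H1 A = {u. square_integrable (lebesgue_on A) u \<and> (\<exists>G. is_weak_gradient A u G)}"

text \<open>Determined up to a null set for \<open>u \<in> H1 A\<close>.\<close>
definition weak_gradient :: "'a::euclidean_space set \<Rightarrow> ('a \<Rightarrow> real) \<Rightarrow> 'a \<Rightarrow> 'a" where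
  "weak_gradient A u = (SOME G. is_weak_gradient A u G)"

text \<open>
  \<open>\<tau>\<close> is the trace of \<open>u \<in> H1 A\<close> on the part \<open>\<Gamma>\<close> of the boundary of the bounded Lipschitz set
  \<open>A\<close>: the trace operator is the extension by continuity, from $H^1(A)$ to $L^2(\Gamma)$, of the
  restriction to \<open>\<Gamma>\<close> of functions that are smooth up to the boundary.
\<close>
definition has_trace ::
    "'a::euclidean_space set \<Rightarrow> 'a set \<Rightarrow> ('a \<Rightarrow> real) \<Rightarrow> ('a \<Rightarrow> real) \<Rightarrow> bool" where
  "has_trace A \<Gamma> u \<tau> \<longleftrightarrow> square_integrable (surface_measure \<Gamma>) \<tau> \<and>
     (\<exists>f :: nat \<Rightarrow> 'a \<Rightarrow> real. (\<forall>n. smooth_on UNIV (f n)) \<and>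
        (\<lambda>n. LINT x|lebesgue_on A. (f n x - u x)\<^sup>2 + (norm (gradient (f n) x - weak_gradient A u x))\<^sup>2)
          \<longlonglongrightarrow> 0 \<and>
        (\<lambda>n. LINT x|surface_measure \<Gamma>. (f n x - \<tau> x)\<^sup>2) \<longlonglongrightarrow> 0)"

text \<open>
  Sobolev--Slobodeckij definition on the $(d-1)$-dimensional surface \<open>\<Gamma>\<close>: the exponent in the
  Gagliardo seminorm is $(d-1) + 2 \cdot \frac12 = d$. The convention \<open>0 / 0 = 0\<close> discards the
  diagonal, which is a null set when $d \ge 2$ and contributes nothing when $d = 1$.
\<close>
definition gagliardo :: "('a::euclidean_space \<Rightarrow> real) \<Rightarrow> 'a \<times> 'a \<Rightarrow> real" where
  "gagliardo g = (\<lambda>(x, y). (g x - g y)\<^sup>2 / dist x y ^ DIM('a))"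

definition H_half :: "'a::euclidean_space set \<Rightarrow> ('a \<Rightarrow> real) set" where
  "H_half \<Gamma> = {g. square_integrable (surface_measure \<Gamma>) g \<and>
     integrable (surface_measure \<Gamma> \<Otimes>\<^sub>M surface_measure \<Gamma>) (gagliardo g)}"

definition H_half_norm :: "'a::euclidean_space set \<Rightarrow> ('a \<Rightarrow> real) \<Rightarrow> real" where
  "H_half_norm \<Gamma> g = sqrt ((LINT x|surface_measure \<Gamma>. (g x)\<^sup>2) +
     (LINT p|(surface_measure \<Gamma> \<Otimes>\<^sub>M surface_measure \<Gamma>). gagliardo g p))"

text \<open>The dual of $H^{1/2}(\Gamma)$; boundedness makes the functionals respect a.e. equality.\<close>
definition H_minus_half :: "'a::euclidean_space set \<Rightarrow> (('a \<Rightarrow> real) \<Rightarrow> real) set" where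
  "H_minus_half \<Gamma> = {l.
     (\<forall>f\<in>H_half \<Gamma>. \<forall>g\<in>H_half \<Gamma>. l (\<lambda>x. f x + g x) = l f + l g) \<and>
     (\<forall>c. \<forall>f\<in>H_half \<Gamma>. l (\<lambda>x. c * f x) = c * l f) \<and>
     (\<exists>C. \<forall>f\<in>H_half \<Gamma>. \<bar>l f\<bar> \<le> C * H_half_norm \<Gamma> f)}"

definition nontrivial_pair ::
    "'a::euclidean_space set \<Rightarrow> (('a \<Rightarrow> real) \<Rightarrow> real) \<Rightarrow> ('a \<Rightarrow> real) \<Rightarrow> bool" where
  "nontrivial_pair \<Gamma> gN gD \<longleftrightarrow>
     \<not> ((\<forall>f\<in>H_half \<Gamma>. gN f = 0) \<and> (AE x in surface_measure \<Gamma>. gD x = 0))"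

section \<open>The shape optimization problem\<close>

definition obstacle :: "'a::euclidean_space set \<Rightarrow> 'a set \<Rightarrow> bool" where
  "obstacle K \<omega> \<longleftrightarrow> \<omega> \<subseteq> K \<and> lipschitz_open \<omega>"

definition admissible :: "'a::euclidean_space set \<Rightarrow> 'a set \<Rightarrow> 'a set set" where
  "admissible \<Omega> K = {\<Omega> - closure \<omega> | \<omega>. obstacle K \<omega>}"

definition admissible_cone :: "'a::euclidean_space set \<Rightarrow> 'a set \<Rightarrow> real \<Rightarrow> 'a set set" where
  "admissible_cone \<Omega> K \<epsilon> =
     {\<Omega> - closure \<omega> | \<omega>. open \<omega> \<and> \<omega> \<subseteq> K \<and> cone_property \<epsilon> (- closure \<omega>)}"

text \<open>
  Weak formulation of $-\Delta u + u = 0$ in $A = \Omega \setminus \overline\omega$,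
  $\partial_\nu u = g_N$ on $\partial\Omega$, $u = 0$ on $\partial\omega$.
\<close>
definition weak_solution ::
    "'a::euclidean_space set \<Rightarrow> 'a set \<Rightarrow> (('a \<Rightarrow> real) \<Rightarrow> real) \<Rightarrow> ('a \<Rightarrow> real) \<Rightarrow> bool" where
  "weak_solution \<Omega> \<omega> gN u \<longleftrightarrow>
     (let A = \<Omega> - closure \<omega> in
        u \<in> H1 A \<and> has_trace A (frontier \<omega>) u (\<lambda>_. 0) \<and>
        (\<forall>v \<tau>. v \<in> H1 A \<longrightarrow> has_trace A (frontier \<omega>) v (\<lambda>_. 0) \<longrightarrow>
           has_trace A (frontier \<Omega>) v \<tau> \<longrightarrow>
           (LINT x|lebesgue_on A. weak_gradient A u x \<bullet> weak_gradient A v x + u x * v x) = gN \<tau>))"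

text \<open>
  For \<open>A \<in> admissible \<Omega> K\<close> the set \<open>\<omega>\<close> is the interior of \<open>\<Omega> - A\<close> and, by Lax--Milgram, \<open>u\<close>
  and its trace \<open>\<tau>\<close> exist and are unique up to null sets, so that exactly one value qualifies.
\<close>
definition misfit ::
    "'a::euclidean_space set \<Rightarrow> 'a set \<Rightarrow> (('a \<Rightarrow> real) \<Rightarrow> real) \<Rightarrow> ('a \<Rightarrow> real) \<Rightarrow> 'a set \<Rightarrow> real" where
  "misfit \<Omega> K gN gD A =
     (THE l. \<exists>\<omega> u \<tau>. obstacle K \<omega> \<and> A = \<Omega> - closure \<omega> \<and>
        weak_solution \<Omega> \<omega> gN u \<and> has_trace A (frontier \<Omega>) u \<tau> \<and>
        l = (1 / 2) * (LINT x|surface_measure (frontier \<Omega>). (\<tau> x - gD x)\<^sup>2))"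

end

theory Submission
  imports Defs
begin

text \<open>
  The theorem rests on the classical equivalence between Lipschitz boundaries and cone conditions,
  in the following quantitative form for an open \<open>\<omega>\<close> contained in the compact set \<open>K\<close>.

  If \<open>\<omega>\<close> is Lipschitz, then the complement of its closure has the \<open>\<epsilon>\<close>-cone property for all
  sufficiently small \<open>\<epsilon>\<close> (\<open>lipschitz_imp_exterior_cone_property\<close>, \<open>cone_property_antimono\<close>): above an
  \<open>L\<close>-Lipschitz graph one can move in every direction that makes an angle less than
  \<open>arctan (1 / L)\<close> with the vertical, and the compact boundary of \<open>\<omega>\<close> is covered by finitely many
  graphs, so that one angle and one radius serve all its points. This yields the threshold
  \<open>\<epsilon>\<^sub>0\<close> and puts the minimizer into the smaller class.

  Conversely, if the complement of \<open>closure \<omega>\<close> has the \<open>\<epsilon>\<close>-cone property with \<open>\<epsilon> < pi / 2\<close>, then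
  near a boundary point it is a union of vertical half-lines, whose lowest points form a graph with
  slope at most \<open>1 / tan \<epsilon>\<close>. Here \<open>\<omega>\<close> itself may fail to be Lipschitz, since it can be slit without
  changing its closure; but \<open>interior (closure \<omega>)\<close> is Lipschitz, lies in the closed set \<open>K\<close> and
  describes the same set \<open>\<Omega> - closure \<omega>\<close> (\<open>exterior_cone_property_imp_lipschitz\<close>). Hence
  \<open>admissible_cone \<Omega> K \<epsilon>\<close> is a subset of \<open>admissible \<Omega> K\<close>, and a minimizer over the larger class
  that belongs to the smaller one is a minimizer there.
\<close>

section \<open>Orthogonal decomposition and cones\<close>

lemma perp_diff: "perp e (u - v) = perp e u - perp e v"
  by (simp add: perp_def algebra_simps)

lemma perp_inner_axis: "norm e = 1 \<Longrightarrow> perp e v \<bullet> e = 0"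
  by (simp add: perp_def dot_square_norm inner_diff_left)

lemma perp_eq_self: "v \<bullet> e = 0 \<Longrightarrow> perp e v = v"
  by (simp add: perp_def)

lemma perp_perp: "norm e = 1 \<Longrightarrow> perp e (perp e v) = perp e v"
  by (simp add: perp_eq_self perp_inner_axis)

lemma perp_add_axis: "perp e v + (v \<bullet> e) *\<^sub>R e = v"
  by (simp add: perp_def)

lemma norm_perp_pythagoras:
  assumes "norm e = 1"
  shows "(norm v)\<^sup>2 = (v \<bullet> e)\<^sup>2 + (norm (perp e v))\<^sup>2"
proof -
  have "orthogonal (perp e v) ((v \<bullet> e) *\<^sub>R e)"
    by (simp add: orthogonal_def perp_inner_axis[OF assms])
  from norm_add_Pythagorean[OF this] show ?thesis
    unfolding perp_add_axis by (simp add: assms)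
qed

lemma norm_perp_le:
  assumes "norm e = 1"
  shows "norm (perp e v) \<le> norm v"
  using norm_perp_pythagoras[OF assms, of v]
  by (auto intro: power2_le_imp_le[OF _ norm_ge_zero])

lemma abs_inner_axis_le: "norm e = 1 \<Longrightarrow> \<bar>v \<bullet> e\<bar> \<le> norm v"
  using Cauchy_Schwarz_ineq2[of v e] by simp

text \<open>
  The cone is defined through the angle with its axis, whereas graphs are controlled by slopes. Both
  forms of the condition follow by squaring from the theorem of Pythagoras; each of the two
  inequalities forces \<open>v \<bullet> e \<ge> 0\<close>, which makes squaring reversible.
\<close>
lemma mem_cone_iff_slope:
  assumes e: "norm e = 1" and \<epsilon>: "0 < \<epsilon>" "\<epsilon> < pi / 2"
  shows "z \<in> cone y e \<epsilon> \<longleftrightarrow>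
    norm (perp e (z - y)) \<le> tan \<epsilon> * ((z - y) \<bullet> e) \<and> z \<noteq> y \<and> norm (z - y) < \<epsilon>"
proof -
  define v where "v = z - y"
  define a where "a = v \<bullet> e"
  define p where "p = norm (perp e v)"
  have c: "cos \<epsilon> > 0" using \<epsilon> by (intro cos_gt_zero) auto
  have s: "sin \<epsilon> > 0" using \<epsilon> by (intro sin_gt_zero) auto
  have p0: "p \<ge> 0" by (simp add: p_def)
  have sc: "(sin \<epsilon>)\<^sup>2 + (cos \<epsilon>)\<^sup>2 = 1" by simp
  have v2: "(norm v)\<^sup>2 = a\<^sup>2 + p\<^sup>2"
    using norm_perp_pythagoras[OF e, of v] by (simp add: a_def p_def)
  have slope: "p \<le> tan \<epsilon> * a \<longleftrightarrow> cos \<epsilon> * p \<le> sin \<epsilon> * a"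
    using c by (simp add: tan_def field_simps)
  have key: "(cos \<epsilon> * norm v)\<^sup>2 \<le> a\<^sup>2 \<longleftrightarrow> (cos \<epsilon> * p)\<^sup>2 \<le> (sin \<epsilon> * a)\<^sup>2"
  proof -
    have "a\<^sup>2 = (sin \<epsilon>)\<^sup>2 * a\<^sup>2 + (cos \<epsilon>)\<^sup>2 * a\<^sup>2"
      using sc by (simp flip: distrib_right)
    then show ?thesis unfolding power_mult_distrib v2 distrib_left by linarith
  qed
  have "cos \<epsilon> * norm v \<le> a \<longleftrightarrow> cos \<epsilon> * p \<le> sin \<epsilon> * a"
  proof
    assume *: "cos \<epsilon> * norm v \<le> a"
    moreover have a0: "0 \<le> a" using * c by (meson mult_nonneg_nonneg less_imp_le norm_ge_zero order_trans)
    ultimately have "(cos \<epsilon> * norm v)\<^sup>2 \<le> a\<^sup>2" using c by (intro power_mono) auto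
    then have "(cos \<epsilon> * p)\<^sup>2 \<le> (sin \<epsilon> * a)\<^sup>2" using key by simp
    then show "cos \<epsilon> * p \<le> sin \<epsilon> * a" by (rule power2_le_imp_le) (use a0 s in auto)
  next
    assume *: "cos \<epsilon> * p \<le> sin \<epsilon> * a"
    have "0 \<le> cos \<epsilon> * p" using c p0 by simp
    then have a0: "0 \<le> a" using * s by (metis order_trans zero_le_mult_iff not_less)
    have "(cos \<epsilon> * p)\<^sup>2 \<le> (sin \<epsilon> * a)\<^sup>2" using * c p0 by (intro power_mono) auto
    then have "(cos \<epsilon> * norm v)\<^sup>2 \<le> a\<^sup>2" using key by simp
    then show "cos \<epsilon> * norm v \<le> a" by (rule power2_le_imp_le) (use a0 in auto)
  qed
  then show ?thesis
    unfolding cone_def using slope by (auto simp: v_def a_def p_def)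
qed

lemma cone_mono:
  assumes "0 \<le> \<delta>" and "\<delta> \<le> \<epsilon>" and "\<epsilon> \<le> pi"
  shows "cone y \<xi> \<delta> \<subseteq> cone y \<xi> \<epsilon>"
proof
  fix z assume "z \<in> cone y \<xi> \<delta>"
  moreover have "cos \<epsilon> * norm (z - y) \<le> cos \<delta> * norm (z - y)"
    using assms by (intro mult_right_mono cos_monotone_0_pi_le) auto
  ultimately show "z \<in> cone y \<xi> \<epsilon>"
    using \<open>\<delta> \<le> \<epsilon>\<close> unfolding cone_def mem_Collect_eq by linarith
qed

lemma cone_property_antimono:
  assumes "cone_property \<epsilon> \<Theta>" and "0 \<le> \<delta>" and "\<delta> \<le> \<epsilon>" and "\<epsilon> \<le> pi"
  shows "cone_property \<delta> \<Theta>"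
  unfolding cone_property_def
proof
  fix x assume "x \<in> frontier \<Theta>"
  then obtain \<xi> where \<xi>: "norm \<xi> = 1"
    and in_\<Theta>: "\<And>y. y \<in> closure \<Theta> \<inter> ball x \<epsilon> \<Longrightarrow> cone y \<xi> \<epsilon> \<subseteq> \<Theta>"
    using assms(1) unfolding cone_property_def by blast
  have "cone y \<xi> \<delta> \<subseteq> \<Theta>" if "y \<in> closure \<Theta> \<inter> ball x \<delta>" for y
  proof -
    have "y \<in> closure \<Theta> \<inter> ball x \<epsilon>" using that assms(3) by auto
    then show ?thesis using in_\<Theta> cone_mono[OF assms(2-4)] by blast
  qed
  then show "\<exists>\<xi>. norm \<xi> = 1 \<and> (\<forall>y\<in>closure \<Theta> \<inter> ball x \<delta>. cone y \<xi> \<delta> \<subseteq> \<Theta>)"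
    using \<xi> by blast
qed

section \<open>The exterior of a bounded Lipschitz set has the cone property\<close>

text \<open>
  The vertical direction of the graph at \<open>x\<close> serves as the axis, and an opening \<open>\<rho>\<close> with
  \<open>L * tan \<rho> < 1\<close> works: moving along the cone, the height grows faster than the graph can. The
  vertex ranges over the ball of radius \<open>2 * \<rho>\<close> so that the same axis also works for every point of
  \<open>ball x \<rho>\<close> in place of \<open>x\<close>; this is what the compactness argument needs.
\<close>
lemma exterior_cone_property_near_graph_point:
  fixes \<omega> :: "'a::euclidean_space set"
  assumes lip: "lipschitz_open \<omega>" and x: "x \<in> frontier \<omega>"
  shows "\<exists>\<rho> e. 0 < \<rho> \<and> \<rho> < pi / 2 \<and> norm e = 1 \<and>
    (\<forall>y\<in>closure (- closure \<omega>) \<inter> ball x (2 * \<rho>). cone y e \<rho> \<subseteq> - closure \<omega>)"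
proof -
  have op: "open \<omega>" using lip by (simp add: lipschitz_open_def)
  obtain e r h \<phi> L where e: "norm e = 1" and r: "r > 0" and h: "h > 0"
    and L: "L-lipschitz_on {z. norm (perp e z) < r} (\<phi> \<circ> perp e)"
    and below: "\<omega> \<inter> cylinder x e r h =
      {y \<in> cylinder x e r h. (y - x) \<bullet> e < \<phi> (perp e (y - x))}"
    and graph: "frontier \<omega> \<inter> cylinder x e r h =
      {y \<in> cylinder x e r h. (y - x) \<bullet> e = \<phi> (perp e (y - x))}"
    using lip[unfolded lipschitz_open_def boundary_of_class_def, THEN conjunct2, rule_format, OF x]
    by (elim exE conjE) (rule that; assumption)
  have L0: "L \<ge> 0" using L by (rule lipschitz_on_nonneg)
  (* The opening arctan (1 / (L + 1)) keeps the slope condition strict, also for L = 0; the vertex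
     is at distance less than 2 * \<rho> from x and the cone has length \<rho>, hence the factor 3. *)
  define \<rho> where "\<rho> = min (arctan (1 / (L + 1))) (min r h / 3)"
  have at: "0 < arctan (1 / (L + 1))" using L0 by (simp add: zero_less_arctan_iff)
  have \<rho>0: "0 < \<rho>" using at r h by (simp add: \<rho>_def)
  have \<rho>pi: "\<rho> < pi / 2" using arctan_ubound[of "1 / (L + 1)"] by (simp add: \<rho>_def min_less_iff_disj)
  have "tan \<rho> \<le> tan (arctan (1 / (L + 1)))"
  proof (rule tan_mono_le)
    show "- (pi / 2) < \<rho>" using \<rho>0 pi_gt_zero by linarith
    show "arctan (1 / (L + 1)) < pi / 2" by (rule arctan_ubound)
  qed (simp add: \<rho>_def)
  then have "L * tan \<rho> \<le> L * (1 / (L + 1))"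
    using L0 by (intro mult_left_mono) (auto simp: tan_arctan)
  also have "\<dots> < 1" using L0 by simp
  finally have slope: "L * tan \<rho> < 1" .
  have ball_cyl: "ball x (3 * \<rho>) \<subseteq> cylinder x e r h"
  proof
    fix z assume "z \<in> ball x (3 * \<rho>)"
    then have "norm (z - x) < 3 * \<rho>" by (simp add: dist_norm norm_minus_commute)
    moreover have "3 * \<rho> \<le> r" "3 * \<rho> \<le> h" by (auto simp: \<rho>_def)
    ultimately show "z \<in> cylinder x e r h"
      using norm_perp_le[OF e, of "z - x"] abs_inner_axis_le[OF e, of "z - x"]
      by (simp add: cylinder_def)
  qed
  have "z \<in> - closure \<omega>"
    if y: "y \<in> closure (- closure \<omega>)" "y \<in> ball x (2 * \<rho>)" and z: "z \<in> cone y e \<rho>" for y z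
  proof -
    have zs: "norm (perp e (z - y)) \<le> tan \<rho> * ((z - y) \<bullet> e)" "z \<noteq> y" "norm (z - y) < \<rho>"
      using z mem_cone_iff_slope[OF e \<rho>0 \<rho>pi] by auto
    have "0 < cos \<rho> * norm (z - y)" using zs \<rho>0 \<rho>pi by (simp add: cos_gt_zero)
    then have pos: "(z - y) \<bullet> e > 0" using z by (auto simp: cone_def)
    have ycyl: "y \<in> cylinder x e r h"
      using y \<rho>0 ball_cyl by (auto simp: subset_iff)
    have "dist x z < 3 * \<rho>"
      using dist_triangle[of x z y] y(2) zs(3) by (simp add: dist_norm norm_minus_commute)
    then have zcyl: "z \<in> cylinder x e r h" using ball_cyl by auto
    (* y only lies in the closure of the exterior, hence on or above the graph. *)
    have "y \<notin> \<omega>"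
      using y(1) op open_Int_closure_eq_empty[OF op, of "- closure \<omega>"] closure_subset[of \<omega>] by blast
    then have yab: "(y - x) \<bullet> e \<ge> \<phi> (perp e (y - x))" using below ycyl by force
    have "\<bar>\<phi> (perp e (z - x)) - \<phi> (perp e (y - x))\<bar> \<le> L * norm (perp e (z - x) - perp e (y - x))"
      using lipschitz_onD[OF L, of "perp e (z - x)" "perp e (y - x)"] ycyl zcyl
      by (simp add: perp_perp[OF e] cylinder_def dist_norm)
    also have "perp e (z - x) - perp e (y - x) = perp e (z - y)"
      by (simp flip: perp_diff)
    also have "L * norm (perp e (z - y)) \<le> L * (tan \<rho> * ((z - y) \<bullet> e))"
      using L0 zs by (intro mult_left_mono)
    also have "\<dots> < (z - y) \<bullet> e"
      using mult_strict_right_mono[OF slope pos] by (simp add: mult.assoc)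
    finally have "\<phi> (perp e (z - x)) < \<phi> (perp e (y - x)) + (z - y) \<bullet> e" by linarith
    also have "\<dots> \<le> (z - x) \<bullet> e" using yab by (simp add: inner_diff_left)
    finally have "(z - x) \<bullet> e > \<phi> (perp e (z - x))" .
    then have "z \<notin> \<omega>" "z \<notin> frontier \<omega>" using below graph zcyl by force+
    then show ?thesis using op by (auto simp: frontier_def interior_open)
  qed
  then show ?thesis using \<rho>0 \<rho>pi e by blast
qed

text \<open>
  Finitely many balls \<open>ball c (\<rho> c)\<close> cover the compact boundary; a point of \<open>ball c (\<rho> c)\<close> inherits
  the axis of \<open>c\<close>, and the smallest of the radii serves everywhere.
\<close>
lemma lipschitz_imp_exterior_cone_property:
  fixes \<omega> :: "'a::euclidean_space set"
  assumes bd: "bounded \<omega>" and lip: "lipschitz_open \<omega>"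
  shows "\<exists>\<epsilon>. 0 < \<epsilon> \<and> \<epsilon> < pi / 2 \<and> cone_property \<epsilon> (- closure \<omega>)"
proof -
  obtain \<rho> E where \<rho>: "\<And>x. x \<in> frontier \<omega> \<Longrightarrow> 0 < \<rho> x \<and> \<rho> x < pi / 2 \<and> norm (E x) = 1 \<and>
      (\<forall>y\<in>closure (- closure \<omega>) \<inter> ball x (2 * \<rho> x). cone y (E x) (\<rho> x) \<subseteq> - closure \<omega>)"
    using exterior_cone_property_near_graph_point[OF lip] by metis
  have "frontier \<omega> \<subseteq> (\<Union>x\<in>frontier \<omega>. ball x (\<rho> x))" using \<rho> by force
  then obtain X where X: "X \<subseteq> frontier \<omega>" "finite X" "frontier \<omega> \<subseteq> (\<Union>x\<in>X. ball x (\<rho> x))"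
    using compactE_image[OF compact_frontier_bounded[OF bd]] open_ball by (metis (no_types, lifting))
  (* The extra element 1 makes the minimum meaningful when the boundary is empty. *)
  define \<epsilon> where "\<epsilon> = Min (insert 1 (\<rho> ` X))"
  have \<epsilon>1: "\<epsilon> \<le> 1" and \<epsilon>\<rho>: "\<And>c. c \<in> X \<Longrightarrow> \<epsilon> \<le> \<rho> c" using X(2) by (auto simp: \<epsilon>_def)
  have \<epsilon>0: "0 < \<epsilon>" using X \<rho> by (auto simp: \<epsilon>_def subset_iff)
  have "\<exists>\<xi>. norm \<xi> = 1 \<and> (\<forall>y\<in>closure (- closure \<omega>) \<inter> ball x \<epsilon>. cone y \<xi> \<epsilon> \<subseteq> - closure \<omega>)"
    if "x \<in> frontier (- closure \<omega>)" for x
  proof -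
    have "x \<in> frontier (closure \<omega>)" using that by (simp add: frontier_complement)
    then have "x \<in> frontier \<omega>"
      using interior_mono[OF closure_subset[of \<omega>]] by (auto simp: frontier_def)
    then obtain c where c: "c \<in> X" "x \<in> ball c (\<rho> c)" using X by auto
    have \<rho>c: "0 < \<rho> c" "\<rho> c < pi / 2" "norm (E c) = 1"
      "\<And>y. y \<in> closure (- closure \<omega>) \<inter> ball c (2 * \<rho> c) \<Longrightarrow> cone y (E c) (\<rho> c) \<subseteq> - closure \<omega>"
      using \<rho>[OF subsetD[OF X(1) c(1)]] by blast+
    have "cone y (E c) \<epsilon> \<subseteq> - closure \<omega>" if y: "y \<in> closure (- closure \<omega>) \<inter> ball x \<epsilon>" for y
    proof -
      have "dist c y < 2 * \<rho> c"
        using dist_triangle[of c y x] c y \<epsilon>\<rho>[OF c(1)] by auto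
      then have "cone y (E c) (\<rho> c) \<subseteq> - closure \<omega>" using \<rho>c(4)[of y] y by simp
      moreover have "cone y (E c) \<epsilon> \<subseteq> cone y (E c) (\<rho> c)"
        using \<epsilon>0 \<epsilon>\<rho>[OF c(1)] \<rho>c(2) by (intro cone_mono) auto
      ultimately show ?thesis by blast
    qed
    then show ?thesis using \<rho>c(3) by blast
  qed
  moreover have "\<epsilon> < pi / 2" using \<epsilon>1 pi_gt3 by simp
  ultimately show ?thesis using \<epsilon>0 unfolding cone_property_def by blast
qed

section \<open>The interior complement of a set with the cone property is Lipschitz\<close>

lemma closure_interior_closure_open:
  assumes "open S"
  shows "closure (interior (closure S)) = closure S"
proof
  show "closure (interior (closure S)) \<subseteq> closure S"
    by (intro closure_minimal interior_subset closed_closure)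
  show "closure S \<subseteq> closure (interior (closure S))"
    by (intro closure_mono interior_maximal closure_subset assms)
qed

text \<open>
  Here \<open>k\<close> is the tangent of the opening. The cone with vertex \<open>x\<close> puts all points of the cylinder at
  height at least \<open>h / 2\<close> into \<open>\<Theta>\<close>. A point of \<open>closure \<Theta>\<close> at height at most \<open>- (h / 2)\<close> would have
  \<open>x\<close> in its cone, although \<open>x\<close> is not in the open set \<open>\<Theta>\<close>. So every vertical line enters
  \<open>closure \<Theta>\<close> strictly inside the cylinder, at a height \<open>\<phi>\<close>; once it has entered, the cone condition
  keeps it in \<open>\<Theta>\<close>. Since a boundary point never lies in the cone of another one, the slope of \<open>\<phi>\<close> is
  at most \<open>1 / k\<close>.
\<close>
lemma lipschitz_graph_of_cone_condition:
  fixes \<Theta> :: "'a::euclidean_space set"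
  assumes op: "open \<Theta>" and x: "x \<in> frontier \<Theta>" and e: "norm e = 1"
    and k: "k > 0" and \<delta>: "\<delta> > 0"
    and up: "\<And>y z. \<lbrakk>y \<in> closure \<Theta>; y \<in> ball x \<delta>; z \<in> ball x \<delta>; z \<noteq> y;
      norm (perp e (z - y)) \<le> k * ((z - y) \<bullet> e)\<rbrakk> \<Longrightarrow> z \<in> \<Theta>"
  shows "\<exists>r h \<phi>. r > 0 \<and> h > 0 \<and>
    (\<exists>L. L-lipschitz_on {z. norm (perp e z) < r} (\<phi> \<circ> perp e)) \<and>
    - closure \<Theta> \<inter> cylinder x e r h =
      {y \<in> cylinder x e r h. (y - x) \<bullet> e < \<phi> (perp e (y - x))} \<and>
    frontier \<Theta> \<inter> cylinder x e r h =
      {y \<in> cylinder x e r h. (y - x) \<bullet> e = \<phi> (perp e (y - x))}"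
proof -
  (* The cylinder must fit into ball x \<delta>, and be so thin that the cone of opening k with vertex x
     covers its whole cross-section at height h / 2. *)
  define h where "h = \<delta> / 2"
  define r where "r = min (\<delta> / 2) (k * (h / 2))"
  have h0: "h > 0" using \<delta> by (simp add: h_def)
  have r0: "r > 0" using \<delta> k h0 by (simp add: r_def)
  define H where "H = {v. v \<bullet> e = 0 \<and> norm v < r}"
  define P where "P v t = x + v + t *\<^sub>R e" for v t
  define S where "S v = {t \<in> {-h..h}. P v t \<in> closure \<Theta>}" for v
  define \<phi> where "\<phi> v = Inf (S v)" for v
  have ee: "e \<bullet> e = 1" using e by (simp add: dot_square_norm)
  have xD: "x \<in> closure \<Theta>" and xT: "x \<notin> \<Theta>"
    using x op by (auto simp: frontier_def interior_open)
  have P_ball: "P v t \<in> ball x \<delta>" if "v \<in> H" "\<bar>t\<bar> \<le> h" for v t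
  proof -
    have "norm (v + t *\<^sub>R e) \<le> norm v + \<bar>t\<bar>"
      using norm_triangle_ineq[of v "t *\<^sub>R e"] e by simp
    also have "\<dots> < \<delta>" using that by (auto simp: H_def r_def h_def)
    finally have "norm (v + t *\<^sub>R e) < \<delta>" .
    moreover have "x - P v t = - (v + t *\<^sub>R e)" by (simp add: P_def)
    ultimately show ?thesis by (simp add: dist_norm norm_minus_commute del: minus_add_distrib)
  qed
  have P_diff_axis: "(P v t - P w s) \<bullet> e = t - s"
    and P_diff_perp: "perp e (P v t - P w s) = v - w" if "v \<in> H" "w \<in> H" for v w t s
  proof -
    show ax: "(P v t - P w s) \<bullet> e = t - s"
      using that by (simp add: P_def H_def inner_diff_left inner_add_left ee)
    show "perp e (P v t - P w s) = v - w"
      unfolding perp_def ax by (simp add: P_def algebra_simps)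
  qed
  have upP: "P w s \<in> \<Theta>"
    if "v \<in> H" "w \<in> H" "\<bar>t\<bar> \<le> h" "\<bar>s\<bar> \<le> h" "P v t \<in> closure \<Theta>" "t < s" "norm (w - v) \<le> k * (s - t)"
    for v w t s
  proof -
    have "P w s \<noteq> P v t" using P_diff_axis[of w v s t] that by auto
    then show ?thesis
      using up[of "P v t" "P w s"] P_ball P_diff_axis[of w v s t] P_diff_perp[of w v s t] that by auto
  qed
  have zeroH: "0 \<in> H" using r0 by (simp add: H_def)
  have P00: "P 0 0 = x" by (simp add: P_def)
  have half_S: "h / 2 \<in> S v" if v: "v \<in> H" for v
  proof -
    have "P v (h / 2) \<in> \<Theta>"
      using v h0 xD by (intro upP[OF zeroH v, of 0]) (auto simp: P00 H_def r_def)
    then show ?thesis using h0 closure_subset by (auto simp: S_def)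
  qed
  have S_lower: "- (h / 2) < t" if v: "v \<in> H" and t: "t \<in> S v" for v t
  proof (rule ccontr)
    assume "\<not> - (h / 2) < t"
    then have tt: "h / 2 \<le> - t" by simp
    have "norm (0 - v) \<le> k * (h / 2)" using v by (simp add: H_def r_def)
    also have "\<dots> \<le> k * (0 - t)" using tt k by (intro mult_left_mono) auto
    finally have "P 0 0 \<in> \<Theta>"
      using t tt h0 by (intro upP[OF v zeroH, of t]) (auto simp: S_def)
    then show False using P00 xT by simp
  qed
  have bddS: "bdd_below (S v)" for v by (rule bdd_belowI[of _ "-h"]) (simp add: S_def)
  have closedS: "closed (S v)" for v
  proof -
    have "closed ({-h..h} \<inter> P v -` closure \<Theta>)"
      by (rule continuous_closed_preimage) (auto intro!: continuous_intros simp: P_def)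
    moreover have "{-h..h} \<inter> P v -` closure \<Theta> = S v" by (auto simp: S_def)
    ultimately show ?thesis by simp
  qed
  have \<phi>_S: "\<phi> v \<in> S v" if "v \<in> H" for v
    unfolding \<phi>_def using half_S[OF that] bddS closedS by (intro closed_contains_Inf) auto
  have \<phi>_le: "\<phi> v \<le> t" if "t \<in> S v" for v t
    unfolding \<phi>_def using that bddS by (rule cInf_lower)
  have \<phi>_bound: "\<bar>\<phi> v\<bar> < h" if "v \<in> H" for v
    using S_lower[OF that \<phi>_S[OF that]] \<phi>_le[OF half_S[OF that]] h0 by auto
  have in_T: "P v t \<in> \<Theta> \<longleftrightarrow> \<phi> v < t" if v: "v \<in> H" and t: "\<bar>t\<bar> < h" for v t
  proof
    assume "\<phi> v < t"
    then show "P v t \<in> \<Theta>"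
      using \<phi>_S[OF v] \<phi>_bound[OF v] v t k by (intro upP[OF v v, of "\<phi> v"]) (auto simp: S_def)
  next
    assume PT: "P v t \<in> \<Theta>"
    then obtain d where d: "d > 0" "ball (P v t) d \<subseteq> \<Theta>" using op by (auto simp: open_contains_ball)
    (* As \<Theta> is open, the line already meets it slightly below t, but still above -h. *)
    define t' where "t' = t - min (d / 2) (t + h)"
    have "P v t - P v t' = min (d / 2) (t + h) *\<^sub>R e" by (simp add: P_def t'_def algebra_simps)
    then have "dist (P v t) (P v t') < d" using e d t by (auto simp: dist_norm)
    then have "P v t' \<in> \<Theta>" using d by auto
    then have "t' \<in> S v" using t d(1) closure_subset by (auto simp: S_def t'_def)
    then have "\<phi> v \<le> t'" by (rule \<phi>_le)
    also have "t' < t" using t d(1) by (auto simp: t'_def)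
    finally show "\<phi> v < t" .
  qed
  have in_D: "P v t \<in> closure \<Theta> \<longleftrightarrow> \<phi> v \<le> t" if v: "v \<in> H" and t: "\<bar>t\<bar> < h" for v t
  proof
    assume "P v t \<in> closure \<Theta>"
    then show "\<phi> v \<le> t" using t by (intro \<phi>_le) (auto simp: S_def)
  next
    assume "\<phi> v \<le> t"
    then consider "\<phi> v < t" | "t = \<phi> v" by linarith
    then show "P v t \<in> closure \<Theta>"
      using in_T[OF v t] \<phi>_S[OF v] closure_subset by cases (auto simp: S_def)
  qed
  have \<phi>_step: "\<phi> w \<le> \<phi> v + norm (w - v) / k" if v: "v \<in> H" and w: "w \<in> H" for v w
  proof (rule ccontr)
    assume "\<not> ?thesis"
    then have *: "norm (w - v) / k < \<phi> w - \<phi> v" by simp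
    then have "norm (w - v) \<le> k * (\<phi> w - \<phi> v)" using k by (simp add: field_simps)
    moreover have "\<phi> v < \<phi> w" using * k by (smt (verit) divide_nonneg_pos norm_ge_zero)
    ultimately have "P w (\<phi> w) \<in> \<Theta>"
      using \<phi>_S[OF v] \<phi>_bound[OF v] \<phi>_bound[OF w] by (intro upP[OF v w, of "\<phi> v"]) (auto simp: S_def)
    then show False using in_T[OF w \<phi>_bound[OF w]] by simp
  qed
  have perpH: "perp e z \<in> H" if "norm (perp e z) < r" for z
    using that by (simp add: H_def perp_inner_axis[OF e])
  have "(1 / k)-lipschitz_on {z. norm (perp e z) < r} (\<phi> \<circ> perp e)"
  proof (rule lipschitz_onI)
    fix y z assume "y \<in> {z. norm (perp e z) < r}" "z \<in> {z. norm (perp e z) < r}"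
    then have H: "perp e y \<in> H" "perp e z \<in> H" using perpH by auto
    have "dist ((\<phi> \<circ> perp e) y) ((\<phi> \<circ> perp e) z) \<le> norm (perp e y - perp e z) / k"
      using \<phi>_step[OF H] \<phi>_step[OF H(2,1)] by (simp add: dist_real_def norm_minus_commute abs_le_iff)
    also have "\<dots> \<le> norm (y - z) / k"
      using k norm_perp_le[OF e, of "y - z"] by (simp add: perp_diff divide_right_mono)
    finally show "dist ((\<phi> \<circ> perp e) y) ((\<phi> \<circ> perp e) z) \<le> 1 / k * dist y z"
      by (simp add: dist_norm)
  qed (use k in simp)
  moreover have cyl: "(y \<in> \<Theta> \<longleftrightarrow> \<phi> (perp e (y - x)) < (y - x) \<bullet> e) \<and>
      (y \<in> closure \<Theta> \<longleftrightarrow> \<phi> (perp e (y - x)) \<le> (y - x) \<bullet> e)" if "y \<in> cylinder x e r h" for y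
  proof -
    have "P (perp e (y - x)) ((y - x) \<bullet> e) = y" by (simp add: P_def perp_def)
    then show ?thesis
      using that in_T[of "perp e (y - x)" "(y - x) \<bullet> e"] in_D[of "perp e (y - x)" "(y - x) \<bullet> e"]
        perpH by (simp add: cylinder_def)
  qed
  moreover have "- closure \<Theta> \<inter> cylinder x e r h =
      {y \<in> cylinder x e r h. (y - x) \<bullet> e < \<phi> (perp e (y - x))}"
    using cyl by auto
  moreover have "frontier \<Theta> \<inter> cylinder x e r h =
      {y \<in> cylinder x e r h. (y - x) \<bullet> e = \<phi> (perp e (y - x))}"
    using cyl op by (auto simp: frontier_def interior_open)
  ultimately show ?thesis using r0 h0 by blast
qed

text \<open>
  Passing to \<open>interior (closure \<omega>)\<close>, the interior of the complement of \<open>\<Theta> = - closure \<omega>\<close>, repairs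
  slits and punctures. It has the same boundary as \<open>\<Theta>\<close> and is the complement of \<open>closure \<Theta>\<close>, so the
  graphs found for \<open>\<Theta>\<close> describe it from below. Halving \<open>\<epsilon>\<close> keeps any two points of the ball at
  distance less than \<open>\<epsilon>\<close>, the length of the cones.
\<close>
lemma exterior_cone_property_imp_lipschitz:
  fixes \<omega> :: "'a::euclidean_space set"
  assumes op: "open \<omega>" and \<epsilon>: "0 < \<epsilon>" "\<epsilon> < pi / 2" and cp: "cone_property \<epsilon> (- closure \<omega>)"
  shows "lipschitz_open (interior (closure \<omega>))"
proof -
  define \<Theta> where "\<Theta> = - closure \<omega>"
  have opT: "open \<Theta>" by (simp add: \<Theta>_def open_Compl)
  have U: "interior (closure \<omega>) = - closure \<Theta>" by (simp add: \<Theta>_def closure_complement)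
  have "closure (interior (closure \<omega>)) = closure \<omega>"
    using op by (rule closure_interior_closure_open)
  then have fr: "frontier (interior (closure \<omega>)) = frontier \<Theta>"
    unfolding \<Theta>_def frontier_complement by (simp add: frontier_def)
  have "\<exists>e r h \<phi>. norm e = 1 \<and> r > 0 \<and> h > 0 \<and>
      (\<exists>L. L-lipschitz_on {z. norm (perp e z) < r} (\<phi> \<circ> perp e)) \<and>
      - closure \<Theta> \<inter> cylinder x e r h =
        {y \<in> cylinder x e r h. (y - x) \<bullet> e < \<phi> (perp e (y - x))} \<and>
      frontier \<Theta> \<inter> cylinder x e r h =
        {y \<in> cylinder x e r h. (y - x) \<bullet> e = \<phi> (perp e (y - x))}"
    if x: "x \<in> frontier \<Theta>" for x
  proof -
    obtain e where e: "norm e = 1"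
      and cone: "\<And>y. y \<in> closure \<Theta> \<inter> ball x \<epsilon> \<Longrightarrow> cone y e \<epsilon> \<subseteq> \<Theta>"
      using cp x unfolding cone_property_def \<Theta>_def by blast
    have up: "z \<in> \<Theta>" if "y \<in> closure \<Theta>" "y \<in> ball x (\<epsilon> / 2)" "z \<in> ball x (\<epsilon> / 2)" "z \<noteq> y"
      "norm (perp e (z - y)) \<le> tan \<epsilon> * ((z - y) \<bullet> e)" for y z
    proof -
      have "dist z y < \<epsilon>" using that(2,3) by (auto intro: dist_triangle_half_r)
      then have "z \<in> cone y e \<epsilon>"
        using that by (simp add: mem_cone_iff_slope[OF e \<epsilon>] dist_norm)
      then show ?thesis using cone[of y] that(1,2) \<epsilon>(1) by auto
    qed
    have \<epsilon>2: "0 < \<epsilon> / 2" using \<epsilon> by simp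
    show ?thesis
      using lipschitz_graph_of_cone_condition[OF opT x e tan_gt_zero[OF \<epsilon>] \<epsilon>2 up]
      by (intro exI[of _ e]) (simp only: e simp_thms)
  qed
  then show ?thesis
    unfolding lipschitz_open_def boundary_of_class_def fr unfolding U by auto
qed

section \<open>Admissible sets and minimizers\<close>

text \<open>
  The obstacle witnessing membership has to be changed, from \<open>\<omega>\<close> to \<open>interior (closure \<omega>)\<close>; closedness
  of \<open>K\<close> keeps the new one inside \<open>K\<close>.
\<close>
lemma admissible_cone_subset_admissible:
  assumes "closed K" and "0 < \<epsilon>" and "\<epsilon> < pi / 2"
  shows "admissible_cone \<Omega> K \<epsilon> \<subseteq> admissible \<Omega> K"
proof
  fix A assume "A \<in> admissible_cone \<Omega> K \<epsilon>"
  then obtain \<omega> where \<omega>: "A = \<Omega> - closure \<omega>" "open \<omega>" "\<omega> \<subseteq> K" "cone_property \<epsilon> (- closure \<omega>)"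
    by (auto simp: admissible_cone_def)
  have "obstacle K (interior (closure \<omega>))"
    using exterior_cone_property_imp_lipschitz[OF \<omega>(2) assms(2,3) \<omega>(4)]
      closure_minimal[OF \<omega>(3) assms(1)] interior_subset
    unfolding obstacle_def by blast
  moreover have "closure (interior (closure \<omega>)) = closure \<omega>"
    using \<omega>(2) by (rule closure_interior_closure_open)
  ultimately show "A \<in> admissible \<Omega> K" using \<omega>(1) unfolding admissible_def by blast
qed

lemma admissible_imp_admissible_cone:
  assumes "bounded K" and "A \<in> admissible \<Omega> K"
  shows "\<exists>\<epsilon>\<^sub>0. 0 < \<epsilon>\<^sub>0 \<and> \<epsilon>\<^sub>0 < pi / 2 \<and> (\<forall>\<epsilon>. 0 < \<epsilon> \<and> \<epsilon> < \<epsilon>\<^sub>0 \<longrightarrow> A \<in> admissible_cone \<Omega> K \<epsilon>)"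
proof -
  obtain \<omega> where \<omega>: "A = \<Omega> - closure \<omega>" "\<omega> \<subseteq> K" "lipschitz_open \<omega>"
    using assms(2) by (auto simp: admissible_def obstacle_def)
  obtain \<epsilon>\<^sub>0 where \<epsilon>\<^sub>0: "0 < \<epsilon>\<^sub>0" "\<epsilon>\<^sub>0 < pi / 2" "cone_property \<epsilon>\<^sub>0 (- closure \<omega>)"
    using lipschitz_imp_exterior_cone_property[OF bounded_subset[OF assms(1) \<omega>(2)] \<omega>(3)] by blast
  have "cone_property \<epsilon> (- closure \<omega>)" if "0 < \<epsilon>" "\<epsilon> < \<epsilon>\<^sub>0" for \<epsilon>
    using cone_property_antimono[OF \<epsilon>\<^sub>0(3), of \<epsilon>] that \<epsilon>\<^sub>0(2) pi_gt_zero by simp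
  then show ?thesis
    using \<omega> \<epsilon>\<^sub>0 unfolding admissible_cone_def lipschitz_open_def by blast
qed

theorem proposition2p5:
  fixes \<Omega> K A_opt :: "'a::euclidean_space set"
    and gN :: "('a \<Rightarrow> real) \<Rightarrow> real" and gD :: "'a \<Rightarrow> real"
  assumes "bounded \<Omega>" and "smooth_open \<Omega>" and "connected \<Omega>"
    and "compact K" and "K \<subseteq> \<Omega>"
    and "gN \<in> H_minus_half (frontier \<Omega>)" and "gD \<in> H_half (frontier \<Omega>)"
    and "nontrivial_pair (frontier \<Omega>) gN gD"
    and "is_arg_min (misfit \<Omega> K gN gD) (\<lambda>A. A \<in> admissible \<Omega> K) A_opt"
  shows "\<exists>\<epsilon>\<^sub>0>0. \<forall>\<epsilon>. 0 < \<epsilon> \<and> \<epsilon> < \<epsilon>\<^sub>0 \<longrightarrow>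
     A_opt \<in> admissible_cone \<Omega> K \<epsilon> \<and>
     is_arg_min (misfit \<Omega> K gN gD) (\<lambda>A. A \<in> admissible_cone \<Omega> K \<epsilon>) A_opt"
proof -
  have "A_opt \<in> admissible \<Omega> K" using assms(9) by (simp add: is_arg_min_def)
  then obtain \<epsilon>\<^sub>0 where \<epsilon>\<^sub>0: "0 < \<epsilon>\<^sub>0" "\<epsilon>\<^sub>0 < pi / 2"
    and cone: "\<And>\<epsilon>. 0 < \<epsilon> \<Longrightarrow> \<epsilon> < \<epsilon>\<^sub>0 \<Longrightarrow> A_opt \<in> admissible_cone \<Omega> K \<epsilon>"
    using admissible_imp_admissible_cone[OF compact_imp_bounded[OF assms(4)]] by metis
  have "is_arg_min (misfit \<Omega> K gN gD) (\<lambda>A. A \<in> admissible_cone \<Omega> K \<epsilon>) A_opt"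
    if "0 < \<epsilon>" "\<epsilon> < \<epsilon>\<^sub>0" for \<epsilon>
    using admissible_cone_subset_admissible[OF compact_imp_closed[OF assms(4)], of \<epsilon> \<Omega>]
      cone[OF that] that \<epsilon>\<^sub>0(2) assms(9)
    by (auto simp: is_arg_min_def)
  then show ?thesis using \<epsilon>\<^sub>0(1) cone by blast
qed

end
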